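(* Let $p\in\mathbb{N}_0$ and $k\in\mathbb{N}$. There exists a positive constant $N_{p,k}$, depending only on $p$ and $k$, such that for every $n\in\mathbb{N}$, every $f\in C_p^1[0,\infty)$ and all $x\in(0,\infty)$, $$w_p(x)\,|M_{n,k}(f;x)-f(x)|\le N_{p,k}\,\|f'\|_p\,\frac{x}{\sqrt n}.$$
   Context: $\mathbb{N}=\{1,2,\dots\}$, $\mathbb{N}_0=\mathbb{N}\cup\{0\}$. For $n,k\in\mathbb{N}$ (with $n\ge k$, so that $(n-k)!$ is meaningful) and $x>0$, the general Gamma type operator is $$M_{n,k}(f;x)=\frac{(2n-k+1)!\,x^{n+1}}{n!\,(n-k)!}\int_0^\infty\frac{t^{n-k}}{(x+t)^{2n-k+2}}f(t)\,dt.$$ Weights: $w_0(x)=1$ and $w_p(x)=\frac{1}{1+x^p}$ for $p\ge1$. $C_p[0,\infty)$ is the set of all real-valued functions $f$ for which $w_pf$ is bounded and uniformly continuous on $[0,\infty)$, with norm $\|f\|_p=\sup_{x\in[0,\infty)}w_p(x)|f(x)|$. $C_p^1[0,\infty)$ is the space of all $f\in C_p[0,\infty)$ such that $f'\in C_p[0,\infty)$.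
   Formalization: The formal theorem requires n > p in addition to n ≥ k; for k ≤ n ≤ p no finite constant exists (e.g. p = k = n = 1, with f growing like t²/2 up to R and then levelling off, gives M_{1,1}(f;1) ~ log R while ‖f'‖_p ≤ 1). *)

theory Defs
  imports "HOL-Analysis.Analysis"
begin

text \<open>Functions on $[0,\infty)$ are modelled by total functions on the reals; only their values
  on \<^term>\<open>{0::real..}\<close> matter below.\<close>

definition weight :: "nat \<Rightarrow> real \<Rightarrow> real" where
  "weight p x = (if p = 0 then 1 else 1 / (1 + x ^ p))"

definition C_space :: "nat \<Rightarrow> (real \<Rightarrow> real) set" where
  "C_space p = {f. bounded ((\<lambda>x. weight p x * f x) ` {0..}) \<and>
                   uniformly_continuous_on {0..} (\<lambda>x. weight p x * f x)}"

definition C_norm :: "nat \<Rightarrow> (real \<Rightarrow> real) \<Rightarrow> real" where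
  "C_norm p f = (SUP x\<in>{0..}. weight p x * \<bar>f x\<bar>)"

text \<open>The derivative on $[0,\infty)$, one-sided at the endpoint $0$.\<close>

definition deriv_nonneg :: "(real \<Rightarrow> real) \<Rightarrow> real \<Rightarrow> real" where
  "deriv_nonneg f x = vector_derivative f (at x within {0..})"

definition C1_space :: "nat \<Rightarrow> (real \<Rightarrow> real) set" where
  "C1_space p = {f \<in> C_space p. f differentiable_on {0..} \<and> deriv_nonneg f \<in> C_space p}"

text \<open>The natural-number subtractions are only intended for \<^term>\<open>k \<le> (n::nat)\<close>.
  For $f$ in \<^term>\<open>C_space p\<close> the integrand is $O(t^{p-n-2})$ at infinity, so the integral
  converges when \<^term>\<open>p \<le> (n::nat)\<close>.\<close>

definition gamma_op :: "nat \<Rightarrow> nat \<Rightarrow> (real \<Rightarrow> real) \<Rightarrow> real \<Rightarrow> real" where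
  "gamma_op n k f x =
     fact (2 * n - k + 1) * x ^ (n + 1) / (fact n * fact (n - k)) *
     (LINT t:{0..}|lborel. t ^ (n - k) / (x + t) ^ (2 * n - k + 2) * f t)"

end

theory Submission imports Defs "HOL-Real_Asymp.Real_Asymp" begin

text \<open>
  For $k \le n$ put $a = n-k$. The operator is then an average: $M_{n,k}(f;x) = E f(T)$, where $T$
  has the scaled beta prime density
  $d(t) = \frac{(a+n+1)!\,x^{n+1}}{a!\,n!}\,\frac{t^a}{(x+t)^{a+n+2}}$ on $[0,\infty)$. All its
  moments of order at most $n$ are explicit quotients of factorials (\<open>beta_prime_moment\<close>), and
  for large $n$ it concentrates around $x$ on the scale $x/\sqrt n$.

  A function with $|f'(u)| \le L\,(1+u^p)$ satisfies
  $|f(t)-f(x)| \le L\,(1+x^p+t^p)\,|t-x|$ by the mean value theorem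
  (\<open>C1_space_increment\<close>), so
  $$|M_{n,k}(f;x)-f(x)| \le L\,\bigl((1+x^p)\,E|T-x| + E\,T^p|T-x|\bigr).$$
  It therefore suffices to show $E\,T^r|T-x| \le K\,x^{r+1}/\sqrt n$ for $r=0$ and $r=p$, with $K$
  depending on $k$ and $r$ only (\<open>beta_prime_absolute_moment\<close>); multiplying by $w_p(x)$ absorbs
  the factor $x^p$.

  The Cauchy--Schwarz inequality would bring in moments of order $2p$, which may be infinite when $n$
  is close to $p$. Instead, $|t-x|$ is split by the weighted arithmetic--geometric mean inequality
  $$|t-x| \le \frac{\sqrt n}{2}\,\frac{(t-x)^2}{x+t} + \frac{1}{2\sqrt n}\,(x+t).$$
  Both terms grow linearly in $t$, just as $|t-x|$ does, so that after multiplication by $t^r$ every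
  integral converges as soon as $r < n$, and one estimate covers all $n > p$. The
  factor $1/(x+t)$ only shifts the parameters of the density, so the first term, too, has an explicit
  mean (\<open>beta_prime_variance\<close>). There the main terms cancel, leaving a quantity of
  order $x^{r+1}/n$.
\<close>

section \<open>The beta integral on the half-line\<close>

lemma beta_ratio_deriv:
  fixes x t :: real
  assumes "x + t \<noteq> 0"
  shows "((\<lambda>t. t / (x + t)) has_real_derivative x / (x + t) ^ 2) (at t)"
    and "((\<lambda>t. 1 / (x + t)) has_real_derivative - 1 / (x + t) ^ 2) (at t)"
  using assms by (auto intro!: derivative_eq_intros simp: power2_eq_square)

text \<open>
  An antiderivative yields integrability and the value of the integral together. For $b=0$ it is
  a power of $t/(x+t)$; the step from $b$ to $b+1$ is the integration by parts
  $$\Bigl(\frac{t^{a+1}}{(x+t)^{a+b+2}}\Bigr)'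
    = (a+1)\,x\,\frac{t^a}{(x+t)^{a+b+3}} - (b+1)\,\frac{t^{a+1}}{(x+t)^{a+b+3}},$$
  which raises $a$; hence the induction on $b$ with $a$ arbitrary.
\<close>

lemma beta_antiderivative:
  fixes x :: real
  assumes "x > 0"
  shows "\<exists>F. (\<forall>t\<ge>0. (F has_real_derivative t ^ a / (x + t) ^ (a + b + 2)) (at t)) \<and> F 0 = 0 \<and>
    (F \<longlongrightarrow> fact a * fact b / (fact (a + b + 1) * x ^ (b + 1))) at_top"
proof (induction b arbitrary: a)
  case 0
  define F where "F = (\<lambda>t. (t / (x + t)) ^ (a + 1) / (real (a + 1) * x))"
  have "(F has_real_derivative t ^ a / (x + t) ^ (a + 0 + 2)) (at t)" if "t \<ge> 0" for t
  proof -
    have nz: "x + t \<noteq> 0" using that assms by simp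
    have "(F has_real_derivative real (a + 1) * (t / (x + t)) ^ a * (x / (x + t) ^ 2) / (real (a + 1) * x)) (at t)"
      unfolding F_def
      by (rule DERIV_cdivide DERIV_power[THEN DERIV_cong] beta_ratio_deriv nz | simp)+
    also have "real (a + 1) * (t / (x + t)) ^ a * (x / (x + t) ^ 2) / (real (a + 1) * x)
        = t ^ a / (x + t) ^ (a + 0 + 2)"
      using assms nz by (simp add: power_divide power_add power2_eq_square del: of_nat_add of_nat_Suc)
    finally show ?thesis .
  qed
  moreover have "F 0 = 0" by (simp add: F_def)
  moreover have "(F \<longlongrightarrow> fact a * fact 0 / (fact (a + 0 + 1) * x ^ (0 + 1))) at_top"
  proof -
    have "((\<lambda>t. t / (x + t)) \<longlongrightarrow> 1) at_top"
      using assms by real_asymp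
    then have "(F \<longlongrightarrow> 1 ^ (a + 1) / (real (a + 1) * x)) at_top"
      unfolding F_def by (intro tendsto_intros) (use assms in auto)
    also have "1 ^ (a + 1) / (real (a + 1) * x) = fact a * fact 0 / (fact (a + 0 + 1) * x ^ (0 + 1))"
      by (simp add: fact_Suc[of a] del: of_nat_add of_nat_Suc fact_Suc)
    finally show ?thesis .
  qed
  ultimately show ?case by blast
next
  case (Suc b)
  obtain F where F: "\<And>t. t \<ge> 0 \<Longrightarrow> (F has_real_derivative t ^ Suc a / (x + t) ^ (Suc a + b + 2)) (at t)"
    "F 0 = 0" "(F \<longlongrightarrow> fact (Suc a) * fact b / (fact (Suc a + b + 1) * x ^ (b + 1))) at_top"
    using Suc.IH[of "Suc a"] by blast
  \<comment> \<open>The boundary term $t^{a+1}/(x+t)^{a+b+2}$ is written with $t/(x+t) \to 1$ and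
    $1/(x+t) \to 0$, which makes its limit immediate.\<close>
  define G where "G = (\<lambda>t. (real (b + 1) * F t + (t / (x + t)) ^ (a + 1) * (1 / (x + t)) ^ (b + 1)) / (real (a + 1) * x))"
  have "(G has_real_derivative t ^ a / (x + t) ^ (a + Suc b + 2)) (at t)" if "t \<ge> 0" for t
  proof -
    have nz: "x + t \<noteq> 0" using that assms by simp
    define u where "u = x + t"
    have q: "((\<lambda>t. (t / (x + t)) ^ (a + 1)) has_real_derivative
        real (a + 1) * (t / (x + t)) ^ a * (x / (x + t) ^ 2)) (at t)"
      by (rule DERIV_power[THEN DERIV_cong] beta_ratio_deriv nz | simp)+
    have q': "((\<lambda>t. (1 / (x + t)) ^ (b + 1)) has_real_derivative
        real (b + 1) * (1 / (x + t)) ^ b * (- 1 / (x + t) ^ 2)) (at t)"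
      by (rule DERIV_power[THEN DERIV_cong] beta_ratio_deriv nz | simp)+
    have "(G has_real_derivative
       (real (b + 1) * (t ^ Suc a / (x + t) ^ (Suc a + b + 2)) +
        (real (a + 1) * (t / (x + t)) ^ a * (x / (x + t) ^ 2) * (1 / (x + t)) ^ (b + 1)
         + (t / (x + t)) ^ (a + 1) * (real (b + 1) * (1 / (x + t)) ^ b * (- 1 / (x + t) ^ 2)))) / (real (a + 1) * x)) (at t)"
      unfolding G_def
      by (rule DERIV_cdivide DERIV_add DERIV_cmult F(1)[OF that] DERIV_mult'[THEN DERIV_cong] q q' | simp)+
    also have "(real (b + 1) * (t ^ Suc a / (x + t) ^ (Suc a + b + 2)) +
        (real (a + 1) * (t / (x + t)) ^ a * (x / (x + t) ^ 2) * (1 / (x + t)) ^ (b + 1)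
         + (t / (x + t)) ^ (a + 1) * (real (b + 1) * (1 / (x + t)) ^ b * (- 1 / (x + t) ^ 2)))) / (real (a + 1) * x)
       = t ^ a / (x + t) ^ (a + Suc b + 2)"
      using assms nz unfolding u_def[symmetric]
      by (simp add: power_divide power_add power2_eq_square del: of_nat_add of_nat_Suc)
    finally show ?thesis .
  qed
  moreover have "G 0 = 0" by (simp add: G_def F)
  moreover have "(G \<longlongrightarrow> fact a * fact (Suc b) / (fact (a + Suc b + 1) * x ^ (Suc b + 1))) at_top"
  proof -
    have l: "((\<lambda>t. t / (x + t)) \<longlongrightarrow> 1) at_top" "((\<lambda>t. 1 / (x + t)) \<longlongrightarrow> 0) at_top"
      using assms by real_asymp+
    have "(G \<longlongrightarrow> (real (b + 1) * (fact (Suc a) * fact b / (fact (Suc a + b + 1) * x ^ (b + 1)))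
        + 1 ^ (a + 1) * 0 ^ (b + 1)) / (real (a + 1) * x)) at_top"
      unfolding G_def by (intro tendsto_intros F l) (use assms in auto)
    also have "(real (b + 1) * (fact (Suc a) * fact b / (fact (Suc a + b + 1) * x ^ (b + 1)))
        + 1 ^ (a + 1) * 0 ^ (b + 1)) / (real (a + 1) * x) =
       fact a * fact (Suc b) / (fact (a + Suc b + 1) * x ^ (Suc b + 1))"
      using assms by (simp add: fact_Suc[of a] fact_Suc[of b] mult_ac del: of_nat_add of_nat_Suc fact_Suc)
    finally show ?thesis .
  qed
  ultimately show ?case by blast
qed

lemma beta_integral:
  fixes x :: real
  assumes "x > 0"
  shows "set_integrable lborel {0..} (\<lambda>t. t ^ a / (x + t) ^ (a + b + 2))"
    and "(LINT t:{0..}|lborel. t ^ a / (x + t) ^ (a + b + 2))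
      = fact a * fact b / (fact (a + b + 1) * x ^ (b + 1))"
proof -
  define T where "T = fact a * fact b / (fact (a + b + 1) * x ^ (b + 1))"
  obtain F where F: "\<And>t. t \<ge> 0 \<Longrightarrow> (F has_real_derivative t ^ a / (x + t) ^ (a + b + 2)) (at t)"
    "F 0 = 0" "(F \<longlongrightarrow> T) at_top"
    using beta_antiderivative[OF assms, of a b] unfolding T_def by blast
  have T0: "T \<ge> 0" using assms by (simp add: T_def)
  have "(\<integral>\<^sup>+t. ennreal (t ^ a / (x + t) ^ (a + b + 2)) * indicator {0..} t \<partial>lborel) = ennreal (T - F 0)"
    by (rule nn_integral_FTC_atLeast) (use assms F in auto)
  then have "(\<integral>\<^sup>+t. ennreal (indicator {0..} t *\<^sub>R (t ^ a / (x + t) ^ (a + b + 2))) \<partial>lborel) = ennreal T"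
    using F(2) by (auto intro!: nn_integral_cong simp: indicator_def elim!: trans[rotated])
  then have "has_bochner_integral lborel (\<lambda>t. indicator {0..} t *\<^sub>R (t ^ a / (x + t) ^ (a + b + 2))) T"
    by (intro has_bochner_integral_nn_integral) (use assms T0 in \<open>auto simp: indicator_def\<close>)
  then show "set_integrable lborel {0..} (\<lambda>t. t ^ a / (x + t) ^ (a + b + 2))"
    "(LINT t:{0..}|lborel. t ^ a / (x + t) ^ (a + b + 2)) = fact a * fact b / (fact (a + b + 1) * x ^ (b + 1))"
    unfolding set_integrable_def set_lebesgue_integral_def T_def[symmetric]
    by (simp_all add: has_bochner_integral_iff)
qed

section \<open>The beta prime distribution and its moments\<close>

text \<open>The density of $x\,S$, where $S$ is beta prime distributed with the parameters $a+1$ and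
  $b+1$.\<close>

definition beta_prime_density :: "nat \<Rightarrow> nat \<Rightarrow> real \<Rightarrow> real \<Rightarrow> real" where
  "beta_prime_density a b x t =
     fact (a + b + 1) * x ^ (b + 1) / (fact b * fact a) * (t ^ a / (x + t) ^ (a + b + 2))"

lemma beta_prime_density_nonneg: "x > 0 \<Longrightarrow> t \<ge> 0 \<Longrightarrow> beta_prime_density a b x t \<ge> 0"
  by (simp add: beta_prime_density_def)

text \<open>Multiplying the kernel by $t^r$ changes $(a,b)$ to $(a+r,b-r)$.\<close>

lemma beta_prime_moment:
  assumes "x > 0" "r \<le> b"
  shows "set_integrable lborel {0..} (\<lambda>t. beta_prime_density a b x t * t ^ r)"
    and "(LINT t:{0..}|lborel. beta_prime_density a b x t * t ^ r)
      = x ^ r * (fact (a + r) * fact (b - r) / (fact a * fact b))"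
proof -
  define C where "C = fact (a + b + 1) * x ^ (b + 1) / (fact b * fact a)"
  have eq: "(\<lambda>t. beta_prime_density a b x t * t ^ r)
      = (\<lambda>t. C * (t ^ (a + r) / (x + t) ^ ((a + r) + (b - r) + 2)))"
    using assms(2) by (simp add: beta_prime_density_def C_def power_add fun_eq_iff)
  show "set_integrable lborel {0..} (\<lambda>t. beta_prime_density a b x t * t ^ r)"
    unfolding eq using beta_integral(1)[OF assms(1)] by (intro set_integrable_mult_right) blast
  have "x ^ (b + 1) = x ^ r * x ^ (b - r + 1)"
    using assms(2) by (simp flip: power_add)
  then show "(LINT t:{0..}|lborel. beta_prime_density a b x t * t ^ r)
      = x ^ r * (fact (a + r) * fact (b - r) / (fact a * fact b))"
    unfolding eq set_integral_mult_right beta_integral(2)[OF assms(1)]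
    using assms by (simp add: C_def del: power_Suc fact_Suc)
qed

text \<open>
  The quotient by $x+t$ raises the exponent of the denominator by one, so the three terms of
  $(t-x)^2$ give beta integrals with the parameters $(a+r+2,b-r-1)$, $(a+r+1,b-r)$ and
  $(a+r,b-r+1)$; only $r < b$ is needed for them to converge. With $A = a+r+1$ and $B = b-r$ their
  combination is proportional to $A(A+1) - 2AB + B(B+1) = (A-B)^2 + (A+B)$: the quadratic terms cancel
  up to $(A-B)^2$, which stays bounded when $b-a$ and $r$ are fixed.
\<close>

lemma beta_prime_variance:
  assumes "x > 0" "r < b"
  shows "set_integrable lborel {0..} (\<lambda>t. beta_prime_density a b x t * (t ^ r * (t - x) ^ 2 / (x + t)))"
    and "(LINT t:{0..}|lborel. beta_prime_density a b x t * (t ^ r * (t - x) ^ 2 / (x + t)))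
      = x ^ (r + 1) * (fact (a + r) * fact (b - r - 1) / (fact a * fact b) *
          (((real a - real b + 2 * real r + 1) ^ 2 + real (a + b + 1)) / real (a + b + 2)))"
proof -
  define C where "C = fact (a + b + 1) * x ^ (b + 1) / (fact b * fact a)"
  obtain c where b: "b = r + c + 1" using assms(2) by (metis add.assoc less_iff_Suc_add Suc_eq_plus1 add_Suc_right)
  let ?J = "\<lambda>a b t. t ^ a / (x + t) ^ (a + b + 2)"
  define h where "h = (\<lambda>t. C * (?J (a + r + 2) c t - 2 * x * ?J (a + r + 1) (c + 1) t
            + x ^ 2 * ?J (a + r) (c + 2) t))"
  have eq: "beta_prime_density a b x t * (t ^ r * (t - x) ^ 2 / (x + t)) = h t" if "t \<in> {0..}" for t
  proof -
    have e: "a + r + 2 + c + 2 = Suc (a + b + 2)" "a + r + 1 + (c + 1) + 2 = Suc (a + b + 2)"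
      "a + r + (c + 2) + 2 = Suc (a + b + 2)"
      by (simp_all add: b)
    have "beta_prime_density a b x t * (t ^ r * (t - x) ^ 2 / (x + t))
      = C * (t ^ (a + r) * (t - x) ^ 2 / (x + t) ^ Suc (a + b + 2))"
      unfolding beta_prime_density_def C_def[symmetric] by (simp add: power_add mult_ac)
    also have "t ^ (a + r) * (t - x) ^ 2
      = t ^ (a + r + 2) - 2 * x * t ^ (a + r + 1) + x ^ 2 * t ^ (a + r)"
      by (simp add: power2_diff power_add power2_eq_square algebra_simps)
    finally show ?thesis
      unfolding h_def e by (simp only: diff_divide_distrib add_divide_distrib times_divide_eq_right)
  qed
  note I = beta_integral[OF assms(1)]
  have i: "set_integrable lborel {0..} h"
    unfolding h_def by (intro set_integrable_mult_right set_integral_add set_integral_diff I)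
  then show "set_integrable lborel {0..} (\<lambda>t. beta_prime_density a b x t * (t ^ r * (t - x) ^ 2 / (x + t)))"
    by (subst set_integrable_cong[OF refl refl eq]) auto
  have "(LINT t:{0..}|lborel. beta_prime_density a b x t * (t ^ r * (t - x) ^ 2 / (x + t)))
     = (LINT t:{0..}|lborel. h t)"
    by (rule set_lebesgue_integral_cong) (use eq in auto)
  also have "\<dots> = C * ((LINT t:{0..}|lborel. ?J (a + r + 2) c t) - 2 * x * (LINT t:{0..}|lborel. ?J (a + r + 1) (c + 1) t)
            + x ^ 2 * (LINT t:{0..}|lborel. ?J (a + r) (c + 2) t))"
    unfolding h_def set_integral_mult_right
    by (simp only: set_integral_add set_integral_diff set_integrable_mult_right I set_integral_mult_right)
  also have "\<dots> = x ^ (r + 1) * (fact (a + r) * fact c / (fact a * fact b) *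
          (((real a - real b + 2 * real r + 1) ^ 2 + real (a + b + 1)) / real (a + b + 2)))"
  proof -
    define D :: real where "D = fact (a + b + 1)"
    have D: "D \<noteq> 0" by (simp add: D_def)
    have fD: "fact (a + r + 2 + c + 1) = real (a + b + 2) * D" 
      "fact (a + r + 1 + (c + 1) + 1) = real (a + b + 2) * D"
      "fact (a + r + (c + 2) + 1) = real (a + b + 2) * D"
      unfolding D_def b by (simp_all add: algebra_simps)
    have f1: "fact (a + r + 2) = real (a + r + 2) * (real (a + r + 1) * fact (a + r))"
        "fact (a + r + 1) = real (a + r + 1) * fact (a + r)"
        "fact (c + 2) = real (c + 2) * (real (c + 1) * fact c)"
        "fact (c + 1) = real (c + 1) * fact c" by (simp_all add: algebra_simps)
    have xb: "x ^ (b + 1) = x ^ (r + 1) * x ^ (c + 1)" by (simp add: b power_add)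
    have "C * (fact (a + r + 2) * fact c / (fact (a + r + 2 + c + 1) * x ^ (c + 1)) -
        2 * x * (fact (a + r + 1) * fact (c + 1) / (fact (a + r + 1 + (c + 1) + 1) * x ^ (c + 1 + 1))) +
        x ^ 2 * (fact (a + r) * fact (c + 2) / (fact (a + r + (c + 2) + 1) * x ^ (c + 2 + 1))))
     = x ^ (r + 1) * (fact (a + r) * fact c / (fact a * fact b)) *
        ((real (a + r + 2) * real (a + r + 1) - 2 * real (a + r + 1) * real (c + 1) + real (c + 2) * real (c + 1)) / real (a + b + 2))"
      unfolding C_def D_def[symmetric] fD f1 xb using assms(1) D
      by (simp add: power_add field_simps power2_eq_square del: of_nat_add of_nat_Suc)
    also have "real (a + r + 2) * real (a + r + 1) - 2 * real (a + r + 1) * real (c + 1) + real (c + 2) * real (c + 1)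
       = (real a - real b + 2 * real r + 1) ^ 2 + real (a + b + 1)"
      unfolding b by (simp add: algebra_simps power2_eq_square)
    finally show ?thesis unfolding I by (simp add: mult.assoc)
  qed
  finally show "(LINT t:{0..}|lborel. beta_prime_density a b x t * (t ^ r * (t - x) ^ 2 / (x + t)))
      = x ^ (r + 1) * (fact (a + r) * fact (b - r - 1) / (fact a * fact b) *
          (((real a - real b + 2 * real r + 1) ^ 2 + real (a + b + 1)) / real (a + b + 2)))"
    by (simp add: b)
qed

section \<open>The first absolute moment about $x$\<close>

text \<open>Crude comparisons of rising and falling factorials with powers of $b$. The first one follows
  from $a+j \le b-1+j \le bj$ for $j \ge 1$, the second one from $b \le (b-j)(j+1)$ for
  $j < b$.\<close>

lemma fact_add_le: "a < b \<Longrightarrow> fact (a + r) \<le> fact a * real b ^ r * fact r"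
proof (induction r)
  case (Suc r)
  have "a + Suc r \<le> b + r" using Suc.prems by simp
  also have "\<dots> \<le> b * Suc r" using Suc.prems by (cases b) auto
  finally have "real (a + Suc r) \<le> real b * real (Suc r)" by (metis of_nat_mono of_nat_mult)
  then have "real (a + Suc r) * fact (a + r) \<le> (real b * real (Suc r)) * (fact a * real b ^ r * fact r)"
    using Suc by (intro mult_mono) auto
  then show ?case by (simp add: algebra_simps)
qed simp

lemma fact_diff_le: "r \<le> b \<Longrightarrow> fact (b - r) * real b ^ r \<le> fact b * fact r"
proof (induction r)
  case (Suc r)
  obtain c where b: "b = r + c + 1" using Suc.prems by (metis add.assoc le_Suc_ex add.commute Suc_eq_plus1)
  have "b \<le> (c + 1) * Suc r" unfolding b by simp
  then have "real b \<le> real (c + 1) * real (Suc r)" by (metis of_nat_mono of_nat_mult)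
  then have "fact c * real b ^ r * real b \<le> fact c * real b ^ r * (real (c + 1) * real (Suc r))"
    by (intro mult_left_mono) auto
  then have "fact c * real b ^ Suc r \<le> fact c * real b ^ r * (real (c + 1) * real (Suc r))"
    by (simp only: power_Suc mult_ac)
  also have "\<dots> = real (Suc r) * (fact (b - r) * real b ^ r)"
    by (simp add: b algebra_simps)
  also have "\<dots> \<le> real (Suc r) * (fact b * fact r)"
    using Suc by (intro mult_left_mono) auto
  finally show ?case by (simp add: b algebra_simps)
qed simp

text \<open>The two summands come from the two terms of the splitting of $|t-x|$: the first one bounds
  $b$ times the mean of $t^r(t-x)^2/(x+t)$ (up to the power of $x$), where $k = b-a$, and the second
  one bounds the mean of $t^r(x+t)$.\<close>

definition moment_const :: "nat \<Rightarrow> nat \<Rightarrow> real" where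
  "moment_const k r = (fact r * fact (r + 1) * ((2 * real r + 1 - real k) ^ 2 + 1)
     + (fact r * fact r + fact (r + 1) * fact (r + 1))) / 2"

lemma moment_const_pos: "moment_const k r > 0"
  unfolding moment_const_def by (intro divide_pos_pos add_nonneg_pos mult_nonneg_nonneg) (auto intro!: add_pos_pos)

lemma fact_ratio_le: "a < b \<Longrightarrow> s \<le> b \<Longrightarrow>
  fact (a + r) * fact (b - s) / (fact a * fact b) * real b ^ s \<le> fact r * fact s * real b ^ r"
proof -
  assume *: "a < b" "s \<le> b"
  have "fact (a + r) * (fact (b - s) * real b ^ s) \<le> (fact a * real b ^ r * fact r) * (fact b * fact s)"
    using * by (intro mult_mono fact_add_le fact_diff_le) auto
  then show ?thesis by (simp add: field_simps)
qed

text \<open>Integrate the pointwise bound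
  $|t-x| \le \frac{\sqrt b}{2}\frac{(t-x)^2}{x+t} + \frac{1}{2\sqrt b}(x+t)$ against
  $t^r$ times the density. The coefficients balance the two terms: the mean of
  $t^r(t-x)^2/(x+t)$ is of order $x^{r+1}/b$ and that of $t^r(x+t)$ is of order $x^{r+1}$.\<close>

lemma beta_prime_absolute_moment:
  assumes "x > 0" "a < b" "r < b"
  shows "set_integrable lborel {0..} (\<lambda>t. beta_prime_density a b x t * (t ^ r * \<bar>t - x\<bar>))"
    and "(LINT t:{0..}|lborel. beta_prime_density a b x t * (t ^ r * \<bar>t - x\<bar>))
      \<le> moment_const (b - a) r * (x ^ (r + 1) / sqrt (real b))"
proof -
  let ?d = "beta_prime_density a b x"
  define s where "s = sqrt (real b)"
  have s: "s > 0" "s * s = real b" using assms by (auto simp: s_def)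
  define B where "B = (\<lambda>t. s / 2 * (?d t * (t ^ r * (t - x) ^ 2 / (x + t)))
     + 1 / (2 * s) * (?d t * t ^ (r + 1) + x * (?d t * t ^ r)))"
  note V = beta_prime_variance[OF assms(1,3), of a]
  note M0 = beta_prime_moment[OF assms(1) less_imp_le[OF assms(3)], of a]
  note M1 = beta_prime_moment[OF assms(1), of "r+1" b a]
  have r1: "r + 1 \<le> b" using assms by simp
  have iB: "set_integrable lborel {0..} B"
    unfolding B_def by (intro set_integrable_mult_right set_integral_add V M0 M1 r1)
  have dom: "?d t * (t ^ r * \<bar>t - x\<bar>) \<le> B t" if t: "t \<in> {0..}" for t
  proof -
    define u where "u = x + t"
    have u: "u > 0" using t assms by (simp add: u_def)
    \<comment> \<open>the weighted arithmetic--geometric mean inequality, from a nonnegative square\<close>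
    have "0 \<le> (s * \<bar>t - x\<bar> - u) ^ 2 / (2 * s * u)" using s u by simp
    also have "\<dots> = s / 2 * ((t - x) ^ 2 / u) + 1 / (2 * s) * u - \<bar>t - x\<bar>"
      using s u by (simp add: field_simps power2_eq_square)
    finally have "\<bar>t - x\<bar> \<le> s / 2 * ((t - x) ^ 2 / u) + 1 / (2 * s) * u" by simp
    then have "(?d t * t ^ r) * \<bar>t - x\<bar> \<le> (?d t * t ^ r) * (s / 2 * ((t - x) ^ 2 / u) + 1 / (2 * s) * u)"
      using t assms by (intro mult_left_mono) (auto simp: beta_prime_density_nonneg)
    also have "\<dots> = B t" unfolding B_def u_def by (simp add: algebra_simps add_divide_distrib)
    finally show ?thesis by (simp add: mult.assoc)
  qed
  show i: "set_integrable lborel {0..} (\<lambda>t. ?d t * (t ^ r * \<bar>t - x\<bar>))"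
  proof (rule set_integrable_bound[OF iB])
    show "set_borel_measurable lborel {0..} (\<lambda>t. ?d t * (t ^ r * \<bar>t - x\<bar>))"
      unfolding set_borel_measurable_def beta_prime_density_def by measurable
    show "AE t in lborel. t \<in> {0..} \<longrightarrow> norm (?d t * (t ^ r * \<bar>t - x\<bar>)) \<le> norm (B t)"
    proof (intro AE_I2 impI)
      fix t :: real assume t: "t \<in> {0..}"
      then have "0 \<le> ?d t * (t ^ r * \<bar>t - x\<bar>)" using assms by (simp add: beta_prime_density_nonneg)
      then show "norm (?d t * (t ^ r * \<bar>t - x\<bar>)) \<le> norm (B t)" using dom[OF t] by simp
    qed
  qed
  define R where "R = ((real a - real b + 2 * real r + 1) ^ 2 + real (a + b + 1)) / real (a + b + 2)"
  define K where "K = (2 * real r + 1 - real (b - a)) ^ 2 + 1"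
  have R: "R \<ge> 0" "R \<le> K"
  proof -
    show "R \<ge> 0" by (simp add: R_def)
    have e: "real a - real b + 2 * real r + 1 = 2 * real r + 1 - real (b - a)"
      using assms by (simp add: of_nat_diff)
    have "(2 * real r + 1 - real (b - a)) ^ 2 * 1 \<le> (2 * real r + 1 - real (b - a)) ^ 2 * real (a + b + 2)"
      by (intro mult_left_mono) auto
    then show "R \<le> K" unfolding R_def K_def e by (simp add: field_simps)
  qed
  \<comment> \<open>All factorial quotients in the three means have this form; for $a < b$ it is at most of order $b^{r-s}$.\<close>
  define E where "E = (\<lambda>r s. fact (a + r) * fact (b - s) / (fact a * fact b) :: real)"
  have E: "E r r \<le> fact r * fact r" "E (r+1) (r+1) \<le> fact (r+1) * fact (r+1)" 
     "E r (r+1) * real b \<le> fact r * fact (r+1)" "E r (r + 1) \<ge> 0"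
  proof -
    have b0: "real b > 0" using assms by simp
    have EE: "E q q \<le> fact q * fact q" if "q \<le> b" for q
    proof -
      have "E q q * real b ^ q \<le> (fact q * fact q) * real b ^ q"
        unfolding E_def by (rule fact_ratio_le[OF assms(2) that])
      then show ?thesis by (rule mult_right_le_imp_le) (use b0 in simp)
    qed
    show "E r r \<le> fact r * fact r" by (rule EE) (use assms in simp)
    show "E (r+1) (r+1) \<le> fact (r+1) * fact (r+1)" by (rule EE[OF r1])
    have "(E r (r+1) * real b) * real b ^ r \<le> (fact r * fact (r+1)) * real b ^ r"
      using fact_ratio_le[OF assms(2) r1, of r] unfolding E_def
      by (simp only: power_Suc Suc_eq_plus1[symmetric] mult.assoc)
    then show "E r (r+1) * real b \<le> fact r * fact (r+1)"
      using b0 by (simp del: fact_Suc)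
    show "E r (r + 1) \<ge> 0" by (simp add: E_def)
  qed
  have "(LINT t:{0..}|lborel. ?d t * (t ^ r * \<bar>t - x\<bar>)) \<le> (LINT t:{0..}|lborel. B t)"
    by (rule set_integral_mono[OF i iB dom])
  also have "\<dots> = s / 2 * (x ^ (r + 1) * (E r (r + 1) * R))
     + 1 / (2 * s) * (x ^ (r + 1) * E (r + 1) (r + 1) + x * (x ^ r * E r r))"
    unfolding B_def E_def R_def using r1
    by (simp only: set_integral_add set_integrable_mult_right V M0 M1 set_integral_mult_right diff_diff_left)
  also have "\<dots> = (x ^ (r + 1) / s) * ((E r (r + 1) * real b * R + (E r r + E (r + 1) (r + 1))) / 2)"
    unfolding s(2)[symmetric] using s(1) by (simp add: field_simps)
  also have "\<dots> \<le> (x ^ (r + 1) / s) * moment_const (b - a) r"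
  proof -
    have "E r (r + 1) * real b * R \<le> fact r * fact (r + 1) * K"
      by (rule mult_mono[OF E(3) R(2)]) (use R in auto)
    then show ?thesis unfolding moment_const_def K_def[symmetric]
      using E s assms by (intro mult_left_mono divide_right_mono add_mono) auto
  qed
  finally show "(LINT t:{0..}|lborel. ?d t * (t ^ r * \<bar>t - x\<bar>))
      \<le> moment_const (b - a) r * (x ^ (r + 1) / sqrt (real b))"
    by (simp add: s_def mult.commute)
qed

section \<open>The weighted function spaces\<close>

lemma weight_bounds:
  assumes "x \<ge> 0"
  shows "weight p x > 0" "weight p x \<le> 1" "weight p x * x ^ p \<le> 1" "1 / weight p x \<le> 1 + x ^ p"
proof -
  have "1 + x ^ p > 0" using assms by (simp add: add_pos_nonneg)
  then show "weight p x > 0" "weight p x \<le> 1" "weight p x * x ^ p \<le> 1" "1 / weight p x \<le> 1 + x ^ p"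
    using assms by (auto simp: weight_def)
qed

lemma C_norm_bound:
  assumes "g \<in> C_space p" "u \<ge> 0"
  shows "\<bar>g u\<bar> \<le> C_norm p g * (1 + u ^ p)" and "0 \<le> C_norm p g"
proof -
  note w = weight_bounds[OF assms(2), of p]
  have "bounded ((\<lambda>x. weight p x * g x) ` {0..})" using assms(1) by (simp add: C_space_def)
  then obtain B where "\<And>x. x \<ge> 0 \<Longrightarrow> \<bar>weight p x * g x\<bar> \<le> B"
    by (auto simp: bounded_iff)
  then have "bdd_above ((\<lambda>x. weight p x * \<bar>g x\<bar>) ` {0..})"
    by (intro bdd_aboveI[of _ B]) (auto simp: abs_mult weight_bounds less_imp_le)
  then have le: "weight p u * \<bar>g u\<bar> \<le> C_norm p g"
    unfolding C_norm_def using assms(2) by (intro cSUP_upper) auto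
  then show "0 \<le> C_norm p g" using w by (smt (verit) mult_nonneg_nonneg abs_ge_zero)
  have "\<bar>g u\<bar> \<le> C_norm p g * (1 / weight p u)" using le w by (simp add: field_simps)
  also have "\<dots> \<le> C_norm p g * (1 + u ^ p)" using \<open>0 \<le> C_norm p g\<close> w by (intro mult_left_mono)
  finally show "\<bar>g u\<bar> \<le> C_norm p g * (1 + u ^ p)" .
qed

text \<open>The mean value inequality on the segment between $x$ and $t$. The bound
  $L\,(1+u^p)$ for $|f'(u)|$ is increasing in $u$, so on this segment it is at most
  $L\,(1+\max(x,t)^p)$, and the maximum is replaced by a sum to make it integrable term by
  term.\<close>

lemma C1_space_increment:
  assumes f: "f \<in> C1_space p" and "x \<ge> 0" "t \<ge> 0"
  shows "\<bar>f t - f x\<bar> \<le> C_norm p (deriv_nonneg f) * ((1 + x ^ p + t ^ p) * \<bar>t - x\<bar>)"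
proof -
  define L where "L = C_norm p (deriv_nonneg f)"
  have g: "deriv_nonneg f \<in> C_space p" and d: "f differentiable_on {0..}"
    using f by (auto simp: C1_space_def)
  have L: "L \<ge> 0" unfolding L_def using C_norm_bound(2)[OF g order_refl] .
  have "norm (f t - f x) \<le> (L * (1 + x ^ p + t ^ p)) * norm (t - x)"
  proof (rule field_differentiable_bound)
    show "convex (closed_segment x t)" "t \<in> closed_segment x t" "x \<in> closed_segment x t" by auto
    fix u assume u: "u \<in> closed_segment x t"
    have u': "min x t \<le> u" "u \<le> max x t" using u by (auto simp: closed_segment_eq_real_ivl split: if_splits)
    have u0: "u \<ge> 0" using u' assms by auto
    have "(f has_vector_derivative deriv_nonneg f u) (at u within {0..})"
      using d u0 unfolding deriv_nonneg_def vector_derivative_works[symmetric] differentiable_on_def by auto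
    then have "(f has_real_derivative deriv_nonneg f u) (at u within {0..})"
      by (simp add: has_real_derivative_iff_has_vector_derivative)
    moreover have "closed_segment x t \<subseteq> {0..}"
      using assms by (auto simp: closed_segment_eq_real_ivl split: if_splits)
    ultimately show "(f has_real_derivative deriv_nonneg f u) (at u within closed_segment x t)"
      by (rule DERIV_subset)
    have "u ^ p \<le> x ^ p + t ^ p"
    proof (cases "x \<le> t")
      case True
      then have "u ^ p \<le> t ^ p" using u' u0 by (intro power_mono) auto
      then show ?thesis using assms by (simp add: add_increasing)
    next
      case False
      then have "u ^ p \<le> x ^ p" using u' u0 by (intro power_mono) auto
      then show ?thesis using assms by (simp add: add_increasing2)
    qed
    then have "L * (1 + u ^ p) \<le> L * (1 + x ^ p + t ^ p)" using L by (intro mult_left_mono) auto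
    then show "norm (deriv_nonneg f u) \<le> L * (1 + x ^ p + t ^ p)"
      using C_norm_bound(1)[OF g u0] unfolding L_def by simp
  qed
  then show ?thesis by (simp add: L_def mult_ac)
qed

section \<open>The approximation error of the Gamma type operator\<close>

lemma gamma_op_eq_beta_prime_mean:
  assumes "k \<le> n"
  shows "gamma_op n k f x = (LINT t:{0..}|lborel. beta_prime_density (n - k) n x t * f t)"
proof -
  have "2 * n - k = n - k + n" using assms by simp
  then show ?thesis
    unfolding gamma_op_def beta_prime_density_def set_integral_mult_right[symmetric]
    by (simp only: mult.assoc)
qed

text \<open>Since the density has total mass $1$, the error is the mean of $f(t)-f(x)$. The integrable
  majorant $D$ from \<open>C1_space_increment\<close> also shows that the integrand in
  \<^const>\<open>gamma_op\<close> is integrable, without which its Lebesgue integral would be the default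
  value $0$.\<close>

lemma gamma_op_error_le:
  assumes "k \<ge> 1" "k \<le> n" "p < n" and f: "f \<in> C1_space p" and "x > 0"
  shows "weight p x * \<bar>gamma_op n k f x - f x\<bar>
    \<le> (2 * moment_const k 0 + moment_const k p) * C_norm p (deriv_nonneg f) * (x / sqrt (real n))"
proof -
  let ?d = "beta_prime_density (n - k) n x"
  define L where "L = C_norm p (deriv_nonneg f)"
  define h where "h = (\<lambda>r t. ?d t * (t ^ r * \<bar>t - x\<bar>))"
  define D where "D = (\<lambda>t. L * ((1 + x ^ p) * h 0 t + h p t))"
  have nk: "n - k < n" "n - (n - k) = k" "0 < n" using assms by auto
  have A: "set_integrable lborel {0..} (h r)"
    "(LINT t:{0..}|lborel. h r t) \<le> moment_const k r * (x ^ (r + 1) / sqrt (real n))" if "r < n" for r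
    using beta_prime_absolute_moment[OF \<open>x > 0\<close> nk(1) that] unfolding h_def nk(2) by simp_all
  note A0 = A[OF nk(3)] and Ap = A[OF \<open>p < n\<close>]
  note w = weight_bounds[OF less_imp_le[OF \<open>x > 0\<close>], of p]
  have L: "L \<ge> 0" 
    unfolding L_def using f C_norm_bound(2)[of "deriv_nonneg f" p 0] by (auto simp: C1_space_def)
  have iD: "set_integrable lborel {0..} D"
    unfolding D_def by (intro set_integrable_mult_right set_integral_add A0 Ap)
  have dom: "\<bar>?d t * (f t - f x)\<bar> \<le> D t" if t: "t \<in> {0..}" for t
  proof -
    have "?d t * \<bar>f t - f x\<bar> \<le> ?d t * (L * ((1 + x ^ p + t ^ p) * \<bar>t - x\<bar>))"
      unfolding L_def using t assms
      by (intro mult_left_mono C1_space_increment[OF f]) (auto simp: beta_prime_density_nonneg)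
    also have "\<dots> = D t" by (simp add: D_def h_def algebra_simps)
    finally show ?thesis
      using t assms by (simp add: abs_mult beta_prime_density_nonneg)
  qed
  have "continuous_on {0..} f"
    using f by (auto simp: C1_space_def intro: differentiable_imp_continuous_on)
  then have fm: "set_borel_measurable lborel {0..} f"
    unfolding set_borel_measurable_def measurable_lborel2
    by (intro borel_measurable_continuous_on_indicator) auto
  have i: "set_integrable lborel {0..} (\<lambda>t. ?d t * (f t - f x))"
  proof (rule set_integrable_bound[OF iD])
    have "(\<lambda>t. ?d t * (indicator {0..} t *\<^sub>R f t - indicator {0..} t *\<^sub>R f x)) \<in> borel_measurable lborel"
      using fm unfolding set_borel_measurable_def beta_prime_density_def by measurable
    also have "(\<lambda>t. ?d t * (indicator {0..} t *\<^sub>R f t - indicator {0..} t *\<^sub>R f x))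
      = (\<lambda>t. indicator {0..} t *\<^sub>R (?d t * (f t - f x)))"
      by (auto simp: indicator_def fun_eq_iff)
    finally show "set_borel_measurable lborel {0..} (\<lambda>t. ?d t * (f t - f x))"
      unfolding set_borel_measurable_def .
    show "AE t in lborel. t \<in> {0..} \<longrightarrow> norm (?d t * (f t - f x)) \<le> norm (D t)"
      using dom by (intro AE_I2 impI) fastforce
  qed
  have i1: "set_integrable lborel {0..} ?d" and m1: "(LINT t:{0..}|lborel. ?d t) = 1"
    using beta_prime_moment[OF \<open>x > 0\<close>, of 0 n "n - k"] by simp_all
  have "gamma_op n k f x = (LINT t:{0..}|lborel. ?d t * (f t - f x) + ?d t * f x)"
    unfolding gamma_op_eq_beta_prime_mean[OF \<open>k \<le> n\<close>] by (simp add: algebra_simps)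
  also have "\<dots> = (LINT t:{0..}|lborel. ?d t * (f t - f x)) + f x"
    using i i1 m1 by (simp add: set_integral_add set_integrable_mult_left set_integral_mult_left)
  finally have "\<bar>gamma_op n k f x - f x\<bar> = norm (LINT t:{0..}|lborel. ?d t * (f t - f x))" by simp
  also have "\<dots> \<le> (LINT t:{0..}|lborel. norm (?d t * (f t - f x)))"
    by (rule set_integral_norm_bound[OF i])
  also have "\<dots> \<le> (LINT t:{0..}|lborel. D t)"
    using dom by (intro set_integral_mono set_integrable_norm[OF i] iD) auto
  also have "\<dots> = L * ((1 + x ^ p) * (LINT t:{0..}|lborel. h 0 t) + (LINT t:{0..}|lborel. h p t))"
    unfolding D_def by (simp only: set_integral_add set_integrable_mult_right A0 Ap set_integral_mult_right)
  also have "\<dots> \<le> L * ((1 + x ^ p) * (moment_const k 0 * (x ^ (0 + 1) / sqrt (real n)))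
      + moment_const k p * (x ^ (p + 1) / sqrt (real n)))"
    using L assms by (intro mult_left_mono add_mono A0 Ap) auto
  also have "\<dots> = L * (x / sqrt (real n)) * ((1 + x ^ p) * moment_const k 0 + x ^ p * moment_const k p)"
    by (simp add: algebra_simps add_divide_distrib)
  finally have "weight p x * \<bar>gamma_op n k f x - f x\<bar>
     \<le> weight p x * (L * (x / sqrt (real n)) * ((1 + x ^ p) * moment_const k 0 + x ^ p * moment_const k p))"
    using w by (intro mult_left_mono) auto
  also have "\<dots> = L * (x / sqrt (real n)) * ((weight p x + weight p x * x ^ p) * moment_const k 0
      + (weight p x * x ^ p) * moment_const k p)"
    by (simp add: algebra_simps)
  also have "\<dots> \<le> L * (x / sqrt (real n)) * ((1 + 1) * moment_const k 0 + 1 * moment_const k p)"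
    using L w assms by (intro mult_left_mono add_mono mult_right_mono) (auto simp: moment_const_pos less_imp_le)
  finally show ?thesis by (simp add: L_def mult_ac)
qed

theorem theorem2:
  fixes p k :: nat
  assumes "k \<ge> 1"
  shows "\<exists>N::real. N > 0 \<and>
    (\<forall>n::nat. n \<ge> k \<longrightarrow> n > p \<longrightarrow>
      (\<forall>f \<in> C1_space p. \<forall>x::real. x > 0 \<longrightarrow>
        weight p x * \<bar>gamma_op n k f x - f x\<bar>
          \<le> N * C_norm p (deriv_nonneg f) * (x / sqrt (real n))))"
proof (intro exI conjI allI impI ballI)
  show "2 * moment_const k 0 + moment_const k p > 0"
    using moment_const_pos[of k 0] moment_const_pos[of k p] by simp
qed (rule gamma_op_error_le[OF assms])

end
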